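(* Let $\mathcal{H}$ be a complex Hilbert space, let $A\in\mathcal{B}(\mathcal{H})$ be a positive operator which is invertible, and let $T\in\mathcal{B}_{A^{1/2}}(\mathcal{H})$. Let $f(z)=\sum_{n=0}^{\infty}c_nz^n$ be a power series with complex coefficients, convergent on the open disk $D(0,R)=\{z\in\mathbb{C}:|z|<R\}$ with $R>0$, and let $f_c(z):=\sum_{n=0}^{\infty}|c_n|z^n$. If $\|T\|_A<R$, then $$r_A\left[f(T)\right]\leq f_c\left(r_A(T)\right),$$ where $f(T)=\sum_{n=0}^{\infty}c_nT^n$ (the limit of the partial sums with respect to $\|\cdot\|_A$).
   Context: $\mathcal{B}(\mathcal{H})$ is the algebra of bounded linear operators on the complex Hilbert space $(\mathcal{H},\langle\cdot\mid\cdot\rangle)$. Positive means $\langle Ax\mid x\rangle\ge 0$ for all $x$; invertible means having a bounded inverse. For positive $A$, put $\langle x\mid y\rangle_A=\langle Ax\mid y\rangle$ and $\|x\|_A=\langle x\mid x\rangle_A^{1/2}=\|A^{1/2}x\|$. $\mathcal{B}_{A^{1/2}}(\mathcal{H})$ is the set of $T\in\mathcal{B}(\mathcal{H})$ for which there is $\lambda>0$ with $\|Tx\|_A\le\lambda\|x\|_A$ for all $x\in\mathcal{H}$ ($A$-bounded operators). For such $T$, $\|T\|_A=\sup\{\|Tx\|_A: x\in\mathcal{H},\ \|x\|_A=1\}$, and the $A$-spectral radius is $r_A(T)=\inf_{n\ge1}\|T^n\|_A^{1/n}=\lim_{n\to\infty}\|T^n\|_A^{1/n}$. (When $A$ is invertible,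 $\|\cdot\|_A$ is a complete norm on $\mathcal{B}_{A^{1/2}}(\mathcal{H})=\mathcal{B}(\mathcal{H})$.) *)

theory Defs
  imports "HOL-Analysis.Analysis"
begin

text \<open>
  Complex Hilbert spaces. Completeness comes from the class \<^class>\<open>banach\<close>. The inner product is
  linear in its first argument. Its positive definiteness is not listed as an axiom, since it follows from
  \<open>norm_eq_sqrt_cinner\<close> and the norm axioms (see \<open>cinner_self_nonneg\<close> and \<open>cinner_self_eq_0_iff\<close>).
  The zero space is allowed.
\<close>

class chilbert_space = banach +
  fixes scaleC :: "complex \<Rightarrow> 'a \<Rightarrow> 'a" (infixr "*\<^sub>C" 75)
    and cinner :: "'a \<Rightarrow> 'a \<Rightarrow> complex"
  assumes scaleC_add_right: "a *\<^sub>C (x + y) = a *\<^sub>C x + a *\<^sub>C y"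
    and scaleC_add_left: "(a + b) *\<^sub>C x = a *\<^sub>C x + b *\<^sub>C x"
    and scaleC_scaleC: "a *\<^sub>C b *\<^sub>C x = (a * b) *\<^sub>C x"
    and scaleR_scaleC: "r *\<^sub>R x = complex_of_real r *\<^sub>C x"
    and cinner_commute: "cinner x y = cnj (cinner y x)"
    and cinner_add_left: "cinner (x + y) z = cinner x z + cinner y z"
    and cinner_scaleC_left: "cinner (a *\<^sub>C x) y = a * cinner x y"
    and norm_eq_sqrt_cinner: "norm x = sqrt (Re (cinner x x))"

lemma scaleC_one: "1 *\<^sub>C x = (x :: 'a :: chilbert_space)"
  using scaleR_scaleC[of 1 x] by simp

lemma cinner_self_nonneg: "cinner x x \<in> \<real>\<^sub>\<ge>\<^sub>0" for x :: "'a :: chilbert_space"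
proof -
  have "Im (cinner x x) = 0"
    using arg_cong[OF cinner_commute[of x x], of Im] by simp
  moreover have "0 \<le> Re (cinner x x)"
    using norm_ge_zero[of x] unfolding norm_eq_sqrt_cinner by simp
  ultimately show ?thesis
    by (simp add: complex_nonneg_Reals_iff)
qed

lemma cinner_self_eq_0_iff: "cinner x x = 0 \<longleftrightarrow> x = 0" for x :: "'a :: chilbert_space"
proof -
  have "x = 0 \<longleftrightarrow> Re (cinner x x) = 0"
    using norm_eq_zero[of x] unfolding norm_eq_sqrt_cinner by simp
  then show ?thesis
    using cinner_self_nonneg[of x] by (auto simp: complex_nonneg_Reals_iff complex_eq_iff)
qed

instantiation complex :: chilbert_space
begin

definition scaleC_complex :: "complex \<Rightarrow> complex \<Rightarrow> complex"
  where "scaleC_complex a x = a * x"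

definition cinner_complex :: "complex \<Rightarrow> complex \<Rightarrow> complex"
  where "cinner_complex x y = x * cnj y"

instance
  by standard
    (simp_all add: scaleC_complex_def cinner_complex_def algebra_simps scaleR_conv_of_real
      cmod_def power2_eq_square)

end

definition bounded_clinear :: "('a :: chilbert_space \<Rightarrow> 'a) \<Rightarrow> bool"
  where "bounded_clinear T \<longleftrightarrow> bounded_linear T \<and> (\<forall>a x. T (a *\<^sub>C x) = a *\<^sub>C T x)"

definition positive_op :: "('a :: chilbert_space \<Rightarrow> 'a) \<Rightarrow> bool"
  where "positive_op A \<longleftrightarrow> bounded_clinear A \<and> (\<forall>x. cinner (A x) x \<in> \<real>\<^sub>\<ge>\<^sub>0)"

definition invertible_op :: "('a :: chilbert_space \<Rightarrow> 'a) \<Rightarrow> bool"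
  where "invertible_op A \<longleftrightarrow> (\<exists>B. bounded_clinear B \<and> A \<circ> B = id \<and> B \<circ> A = id)"

definition A_inner :: "('a :: chilbert_space \<Rightarrow> 'a) \<Rightarrow> 'a \<Rightarrow> 'a \<Rightarrow> complex"
  where "A_inner A x y = cinner (A x) y"

definition A_seminorm :: "('a :: chilbert_space \<Rightarrow> 'a) \<Rightarrow> 'a \<Rightarrow> real"
  where "A_seminorm A x = sqrt (Re (A_inner A x x))"

definition A_bounded_ops :: "('a :: chilbert_space \<Rightarrow> 'a) \<Rightarrow> ('a \<Rightarrow> 'a) set"
  where "A_bounded_ops A =
    {T. bounded_clinear T \<and> (\<exists>l>0. \<forall>x. A_seminorm A (T x) \<le> l * A_seminorm A x)}"

text \<open>
  The supremum is the one in \<open>[0, \<infinity>)\<close>, hence the inserted \<open>0\<close>: it only matters when there is no \<open>x\<close>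
  with \<open>A_seminorm A x = 1\<close> (for invertible \<open>A\<close>: on the zero space), where the supremum is \<open>0\<close>, while
  the real number \<open>Sup {}\<close> is unspecified.
\<close>

definition A_opnorm :: "('a :: chilbert_space \<Rightarrow> 'a) \<Rightarrow> ('a \<Rightarrow> 'a) \<Rightarrow> real"
  where "A_opnorm A T = Sup (insert 0 {A_seminorm A (T x) | x. A_seminorm A x = 1})"

definition A_spectral_radius :: "('a :: chilbert_space \<Rightarrow> 'a) \<Rightarrow> ('a \<Rightarrow> 'a) \<Rightarrow> real"
  where "A_spectral_radius A T = (INF n\<in>{1..}. root n (A_opnorm A (T ^^ n)))"

definition A_sums ::
    "('a :: chilbert_space \<Rightarrow> 'a) \<Rightarrow> (nat \<Rightarrow> 'a \<Rightarrow> 'a) \<Rightarrow> ('a \<Rightarrow> 'a) \<Rightarrow> bool"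
  where "A_sums A S F \<longleftrightarrow> F \<in> A_bounded_ops A \<and>
    (\<lambda>N. A_opnorm A (\<lambda>x. (\<Sum>n<N. S n x) - F x)) \<longlonglongrightarrow> 0"

definition op_power_series ::
    "('a :: chilbert_space \<Rightarrow> 'a) \<Rightarrow> (nat \<Rightarrow> complex) \<Rightarrow> ('a \<Rightarrow> 'a) \<Rightarrow> 'a \<Rightarrow> 'a"
  where "op_power_series A c T = (THE F. A_sums A (\<lambda>n x. c n *\<^sub>C (T ^^ n) x) F)"

end

theory Submission
  imports Defs
begin

text \<open>
  For \<open>s > r\<^sub>A(T)\<close> choose \<open>k \<ge> 1\<close> with \<open>\<parallel>T\<^sup>k\<parallel>\<^sub>A \<le> s\<^sup>k\<close>. The norm
  \<open>p(x) = (\<Sum>j<k. s\<^bsup>k-1-j\<^esup> \<parallel>T\<^sup>j x\<parallel>\<^sub>A)\<close> is equivalent to \<open>\<parallel>\<cdot>\<parallel>\<^sub>A\<close> and satisfies \<open>p(T x) \<le> s p(x)\<close>,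
  so \<open>p(f(T) x) \<le> f\<^sub>c(s) p(x)\<close>. Iterating gives \<open>\<parallel>f(T)\<^sup>n\<parallel>\<^sub>A \<le> C f\<^sub>c(s)\<^sup>n\<close>, and hence
  \<open>r\<^sub>A(f(T)) \<le> f\<^sub>c(s)\<close> on taking \<open>n\<close>-th roots. Now let \<open>s\<close> decrease to \<open>r\<^sub>A(T)\<close>.
\<close>

section \<open>Complex scalars and bounded complex-linear operators\<close>

lemma cinner_add_right: "cinner x (y + z) = cinner x y + cinner x z"
  for x :: "'a :: chilbert_space"
  by (metis cinner_add_left cinner_commute complex_cnj_add)

lemma cinner_scaleC_right: "cinner x (a *\<^sub>C y) = cnj a * cinner x y"
  for x :: "'a :: chilbert_space"
  by (metis cinner_commute cinner_scaleC_left complex_cnj_mult)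

text \<open>The norm axioms give homogeneity for real scalars; for complex ones it comes from the
  inner product, where \<open>a\<close> leaves the first slot and \<open>cnj a\<close> the
  second.\<close>

lemma norm_scaleC: "norm (a *\<^sub>C x) = norm a * norm x"
  for x :: "'a :: chilbert_space"
proof -
  have "cinner (a *\<^sub>C x) (a *\<^sub>C x) = of_real ((norm a)\<^sup>2) * cinner x x"
    unfolding cinner_scaleC_left cinner_scaleC_right complex_norm_square
    by (simp only: mult_ac)
  then have "Re (cinner (a *\<^sub>C x) (a *\<^sub>C x)) = (norm a)\<^sup>2 * Re (cinner x x)"
    by simp
  then show ?thesis
    by (simp add: norm_eq_sqrt_cinner[of x] norm_eq_sqrt_cinner[of "a *\<^sub>C x"] real_sqrt_mult)
qed

lemma scaleR_scaleC_commute: "a *\<^sub>C r *\<^sub>R x = r *\<^sub>R a *\<^sub>C x"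
  for x :: "'a :: chilbert_space"
  by (simp add: scaleR_scaleC scaleC_scaleC mult.commute)

text \<open>Lets finite sums, differences and infinite series pass through a complex scalar.\<close>

lemma bounded_linear_scaleC: "bounded_linear (\<lambda>x. a *\<^sub>C x)"
  for a :: complex
  by (rule bounded_linear_intro[where K = "norm a"])
    (simp_all add: scaleC_add_right norm_scaleC scaleR_scaleC_commute mult.commute)

lemma scaleC_commute: "a *\<^sub>C b *\<^sub>C x = b *\<^sub>C a *\<^sub>C x"
  for x :: "'a :: chilbert_space"
  by (simp add: scaleC_scaleC mult.commute)

lemma scaleC_sum_right: "a *\<^sub>C sum f I = (\<Sum>i\<in>I. a *\<^sub>C f i)"
  for f :: "'i \<Rightarrow> 'a :: chilbert_space"
  using linear_sum[OF bounded_linear.linear[OF bounded_linear_scaleC]] .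

lemma scaleC_diff_right: "a *\<^sub>C (x - y) = a *\<^sub>C x - a *\<^sub>C y"
  for x :: "'a :: chilbert_space"
  using linear_diff[OF bounded_linear.linear[OF bounded_linear_scaleC]] .

lemma bounded_clinearD:
  assumes "bounded_clinear T"
  shows "bounded_linear T" and "T (a *\<^sub>C x) = a *\<^sub>C T x" and "T (x + y) = T x + T y"
    and "T (r *\<^sub>R x) = r *\<^sub>R T x"
  using assms bounded_linear.linear
  by (auto simp: bounded_clinear_def intro: linear_add linear_scale)

lemma bounded_clinear_id: "bounded_clinear (\<lambda>x. x)"
  by (simp add: bounded_clinear_def)

lemma bounded_clinear_compose:
  "bounded_clinear S \<Longrightarrow> bounded_clinear T \<Longrightarrow> bounded_clinear (\<lambda>x. S (T x))"
  by (simp add: bounded_clinear_def bounded_linear_compose)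

lemma bounded_clinear_funpow: "bounded_clinear T \<Longrightarrow> bounded_clinear (T ^^ n)"
  by (induction n) (simp_all add: bounded_clinear_id bounded_clinear_compose id_def o_def)

lemma bounded_clinear_scaleC: "bounded_clinear T \<Longrightarrow> bounded_clinear (\<lambda>x. a *\<^sub>C T x)"
  by (simp add: bounded_clinear_def scaleC_commute
      bounded_linear_compose[OF bounded_linear_scaleC])

lemma bounded_clinear_sum:
  "(\<And>i. i \<in> I \<Longrightarrow> bounded_clinear (S i)) \<Longrightarrow> bounded_clinear (\<lambda>x. \<Sum>i\<in>I. S i x)"
  by (auto simp: bounded_clinear_def scaleC_sum_right intro!: bounded_linear_sum sum.cong)

lemma bounded_clinear_diff:
  "bounded_clinear S \<Longrightarrow> bounded_clinear T \<Longrightarrow> bounded_clinear (\<lambda>x. S x - T x)"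
  by (auto simp: bounded_clinear_def scaleC_diff_right intro: bounded_linear_sub)

lemma A_bounded_opsI:
  assumes "bounded_clinear T" and "\<And>x. A_seminorm A (T x) \<le> l * A_seminorm A x"
    and "\<And>x. 0 \<le> A_seminorm A x"
  shows "T \<in> A_bounded_ops A"
proof -
  \<comment> \<open>\<open>A_bounded_ops\<close> asks for a positive constant, while
    \<open>l\<close> may be zero or negative.\<close>
  have "A_seminorm A (T x) \<le> (\<bar>l\<bar> + 1) * A_seminorm A x" for x
    using assms(2)[of x] mult_right_mono[OF _ assms(3)[of x], of l "\<bar>l\<bar> + 1"] by linarith
  then show ?thesis
    using assms(1) by (auto simp: A_bounded_ops_def intro!: exI[of _ "\<bar>l\<bar> + 1"])
qed

section \<open>The semi-inner product of a positive operator\<close>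

locale positive_operator =
  fixes A :: "'a :: chilbert_space \<Rightarrow> 'a"
  assumes positive: "positive_op A"
begin

text \<open>The real part is a symmetric positive semidefinite real bilinear form, which is enough
  for Cauchy-Schwarz and the triangle inequality.\<close>

abbreviation form :: "'a \<Rightarrow> 'a \<Rightarrow> real"
  where "form x y \<equiv> Re (A_inner A x y)"

lemma clinear: "bounded_clinear A"
  using positive by (simp add: positive_op_def)

lemma A_inner_add_left: "A_inner A (x + y) z = A_inner A x z + A_inner A y z"
  by (simp add: A_inner_def bounded_clinearD(3)[OF clinear] cinner_add_left)

lemma A_inner_add_right: "A_inner A x (y + z) = A_inner A x y + A_inner A x z"
  by (simp add: A_inner_def cinner_add_right)

lemma A_inner_scaleC_left: "A_inner A (a *\<^sub>C x) y = a * A_inner A x y"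
  by (simp add: A_inner_def bounded_clinearD(2)[OF clinear] cinner_scaleC_left)

lemma A_inner_scaleC_right: "A_inner A x (a *\<^sub>C y) = cnj a * A_inner A x y"
  by (simp add: A_inner_def cinner_scaleC_right)

lemma form_nonneg: "0 \<le> form x x"
  using positive by (simp add: positive_op_def A_inner_def complex_nonneg_Reals_iff)

lemma Im_A_inner_self: "Im (A_inner A x x) = 0"
  using positive by (simp add: positive_op_def A_inner_def complex_nonneg_Reals_iff)

text \<open>Polarization along \<open>x + \<i> y\<close>.\<close>

lemma form_commute: "form x y = form y x"
  using Im_A_inner_self[of "x + \<i> *\<^sub>C y"] Im_A_inner_self[of x] Im_A_inner_self[of y]
  by (simp add: A_inner_add_left A_inner_add_right A_inner_scaleC_left A_inner_scaleC_right)

lemma form_scaleR_left: "form (r *\<^sub>R x) y = r * form x y"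
  by (simp add: scaleR_scaleC A_inner_scaleC_left)

lemma form_scaleR_right: "form x (r *\<^sub>R y) = r * form x y"
  by (simp add: scaleR_scaleC A_inner_scaleC_right)

lemma A_seminorm_nonneg: "0 \<le> A_seminorm A x"
  by (simp add: A_seminorm_def form_nonneg)

lemma A_seminorm_square: "(A_seminorm A x)\<^sup>2 = form x x"
  by (simp add: A_seminorm_def form_nonneg)

lemma A_seminorm_scaleC: "A_seminorm A (a *\<^sub>C x) = norm a * A_seminorm A x"
proof -
  have "A_inner A (a *\<^sub>C x) (a *\<^sub>C x) = of_real ((norm a)\<^sup>2) * A_inner A x x"
    unfolding A_inner_scaleC_left A_inner_scaleC_right complex_norm_square
    by (simp only: mult_ac)
  then have "form (a *\<^sub>C x) (a *\<^sub>C x) = (norm a)\<^sup>2 * form x x"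
    by simp
  then show ?thesis
    by (simp add: A_seminorm_def real_sqrt_mult)
qed

lemma A_seminorm_scaleR: "A_seminorm A (r *\<^sub>R x) = \<bar>r\<bar> * A_seminorm A x"
  by (simp add: scaleR_scaleC A_seminorm_scaleC)

lemma form_Cauchy_Schwarz: "form x y \<le> A_seminorm A x * A_seminorm A y"
proof -
  have quad: "0 \<le> u\<^sup>2 * form x x + 2 * u * v * form x y + v\<^sup>2 * form y y" for u v
  proof -
    have "form (u *\<^sub>R x + v *\<^sub>R y) (u *\<^sub>R x + v *\<^sub>R y)
        = u\<^sup>2 * form x x + 2 * u * v * form x y + v\<^sup>2 * form y y"
      using form_commute[of x y]
      by (simp add: A_inner_add_left A_inner_add_right form_scaleR_left form_scaleR_right
          power2_eq_square algebra_simps)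
    then show ?thesis
      using form_nonneg by metis
  qed
  have "(form x y)\<^sup>2 \<le> form x x * form y y"
  proof (cases "form y y = 0")
    case True
    have "form x y = 0"
    proof (rule ccontr)
      assume "form x y \<noteq> 0"
      then show False
        \<comment> \<open>With \<open>form y y = 0\<close> this choice turns the quadratic into
          \<open>- form x x - 2\<close>, which is negative.\<close>
        using quad[of 1 "- (form x x + 1) / form x y"] True form_nonneg[of x] by simp
    qed
    then show ?thesis
      by (simp add: True)
  next
    case False
    then have pos: "0 < form y y"
      using form_nonneg[of y] by simp
    \<comment> \<open>The minimizing direction \<open>u x + v y\<close>, scaled by
      \<open>form y y\<close> to avoid a division.\<close>
    have "0 \<le> form y y * (form x x * form y y - (form x y)\<^sup>2)"
      using quad[of "form y y" "- form x y"] by (simp add: power2_eq_square algebra_simps)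
    then show ?thesis
      using pos by (simp add: zero_le_mult_iff)
  qed
  then have "sqrt ((form x y)\<^sup>2) \<le> A_seminorm A x * A_seminorm A y"
    unfolding A_seminorm_def real_sqrt_mult[symmetric] by (rule real_sqrt_le_mono)
  then show ?thesis
    by simp
qed

lemma A_seminorm_triangle: "A_seminorm A (x + y) \<le> A_seminorm A x + A_seminorm A y"
proof (rule power2_le_imp_le)
  show "(A_seminorm A (x + y))\<^sup>2 \<le> (A_seminorm A x + A_seminorm A y)\<^sup>2"
    using form_Cauchy_Schwarz[of x y] form_commute[of x y]
    by (simp add: A_seminorm_square power2_sum A_inner_add_left A_inner_add_right)
qed (simp add: A_seminorm_nonneg)

lemma A_seminorm_minus: "A_seminorm A (- x) = A_seminorm A x"
  using A_seminorm_scaleR[of "-1" x] by simp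

lemma A_seminorm_zero: "A_seminorm A 0 = 0"
  using A_seminorm_scaleR[of 0 0] by simp

section \<open>The \<open>A\<close>-operator norm and the \<open>A\<close>-spectral radius\<close>

lemma A_opnorm_upper:
  assumes "T \<in> A_bounded_ops A"
  shows "A_seminorm A x = 1 \<Longrightarrow> A_seminorm A (T x) \<le> A_opnorm A T" and "0 \<le> A_opnorm A T"
proof -
  obtain l where l: "0 < l" "\<And>x. A_seminorm A (T x) \<le> l * A_seminorm A x"
    using assms by (auto simp: A_bounded_ops_def)
  let ?S = "insert 0 {A_seminorm A (T x) | x. A_seminorm A x = 1}"
  have "bdd_above ?S"
    using l by (auto intro!: bdd_aboveI[of _ l] dest: order.strict_implies_order)
      (metis mult.right_neutral)
  then show "A_seminorm A x = 1 \<Longrightarrow> A_seminorm A (T x) \<le> A_opnorm A T" and "0 \<le> A_opnorm A T"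
    unfolding A_opnorm_def by (auto intro!: cSup_upper)
qed

lemma A_seminorm_le_A_opnorm:
  assumes T: "T \<in> A_bounded_ops A"
  shows "A_seminorm A (T x) \<le> A_opnorm A T * A_seminorm A x"
proof (cases "A_seminorm A x = 0")
  case True
  \<comment> \<open>Such an \<open>x\<close> cannot be normalized, but \<open>A\<close>-boundedness
    maps null vectors of the seminorm to null vectors.\<close>
  then have "A_seminorm A (T x) \<le> 0"
    using T by (auto simp: A_bounded_ops_def) (metis mult_zero_right)
  then show ?thesis
    by (simp add: True)
next
  case False
  let ?a = "A_seminorm A x"
  have a: "0 < ?a"
    using False A_seminorm_nonneg[of x] by simp
  have "T ((1 / ?a) *\<^sub>R x) = (1 / ?a) *\<^sub>R T x"
    using T by (simp add: A_bounded_ops_def bounded_clinearD)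
  moreover have "A_seminorm A (T ((1 / ?a) *\<^sub>R x)) \<le> A_opnorm A T"
    using a by (intro A_opnorm_upper[OF T]) (simp add: A_seminorm_scaleR)
  ultimately show ?thesis
    using a by (simp add: A_seminorm_scaleR field_simps)
qed

lemma A_opnorm_le:
  assumes "\<And>x. A_seminorm A (T x) \<le> l * A_seminorm A x" and "0 \<le> l"
  shows "A_opnorm A T \<le> l"
  \<comment> \<open>The inserted \<open>0\<close> in the supremum is covered by
    \<open>0 \<le> l\<close>.\<close>
  unfolding A_opnorm_def using assms by (auto intro!: cSup_least) (metis mult.right_neutral)

lemma A_bounded_funpow: "T \<in> A_bounded_ops A \<Longrightarrow> T ^^ n \<in> A_bounded_ops A"
  and A_seminorm_funpow_le:
    "T \<in> A_bounded_ops A \<Longrightarrow> A_seminorm A ((T ^^ n) x) \<le> A_opnorm A T ^ n * A_seminorm A x"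
proof -
  assume T: "T \<in> A_bounded_ops A"
  have *: "A_seminorm A ((T ^^ n) x) \<le> A_opnorm A T ^ n * A_seminorm A x" for x
  proof (induction n)
    case (Suc n)
    have "A_seminorm A ((T ^^ Suc n) x) \<le> A_opnorm A T * A_seminorm A ((T ^^ n) x)"
      using A_seminorm_le_A_opnorm[OF T] by simp
    also have "\<dots> \<le> A_opnorm A T * (A_opnorm A T ^ n * A_seminorm A x)"
      using A_opnorm_upper(2)[OF T] Suc by (rule mult_left_mono[rotated])
    finally show ?case
      by (simp add: mult.assoc)
  qed simp
  then show "A_seminorm A ((T ^^ n) x) \<le> A_opnorm A T ^ n * A_seminorm A x" .
  from * show "T ^^ n \<in> A_bounded_ops A"
    using T A_seminorm_nonneg
    by (intro A_bounded_opsI) (auto simp: A_bounded_ops_def bounded_clinear_funpow)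
qed

lemma A_spectral_radius_lower:
  assumes "T \<in> A_bounded_ops A" and "1 \<le> n"
  shows "A_spectral_radius A T \<le> root n (A_opnorm A (T ^^ n))"
  unfolding A_spectral_radius_def using assms A_opnorm_upper(2)[OF A_bounded_funpow]
  by (intro cINF_lower) (auto intro!: bdd_belowI[of _ 0] real_root_ge_zero)

lemma A_spectral_radius_nonneg: "T \<in> A_bounded_ops A \<Longrightarrow> 0 \<le> A_spectral_radius A T"
  unfolding A_spectral_radius_def using A_opnorm_upper(2)[OF A_bounded_funpow]
  by (intro cINF_greatest) (auto intro!: real_root_ge_zero)

lemma A_spectral_radius_le_A_opnorm:
  "T \<in> A_bounded_ops A \<Longrightarrow> A_spectral_radius A T \<le> A_opnorm A T"
  using A_spectral_radius_lower[of T 1] by simp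

text \<open>An infimum below \<open>s\<close> has a member below \<open>s\<close>. The exponent
  found here fixes the number of terms of the norm \<open>p\<close> constructed later.\<close>

lemma A_spectral_radius_lessD:
  assumes "T \<in> A_bounded_ops A" and "A_spectral_radius A T < s"
  shows "\<exists>k\<ge>1. A_opnorm A (T ^^ k) \<le> s ^ k"
proof -
  obtain k where k: "k \<ge> 1" "root k (A_opnorm A (T ^^ k)) < s"
    using cInf_lessD[OF _ assms(2)[unfolded A_spectral_radius_def]] by auto
  have nn: "0 \<le> A_opnorm A (T ^^ k)"
    using A_opnorm_upper(2)[OF A_bounded_funpow] assms(1) by blast
  have "root k (A_opnorm A (T ^^ k)) ^ k \<le> s ^ k"
    using k nn by (intro power_mono) (auto intro: real_root_ge_zero)
  then show ?thesis
    using k nn by auto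
qed

text \<open>The constant \<open>C\<close> disappears on taking \<open>n\<close>-th roots.\<close>

lemma A_spectral_radius_le:
  assumes F: "F \<in> A_bounded_ops A" and "0 < C" and "0 \<le> q"
    and bound: "\<And>n x. A_seminorm A ((F ^^ n) x) \<le> C * q ^ n * A_seminorm A x"
  shows "A_spectral_radius A F \<le> q"
proof (rule LIMSEQ_le_const)
  show "(\<lambda>n. root n C * q) \<longlonglongrightarrow> q"
    using tendsto_mult[OF LIMSEQ_root_const[OF \<open>0 < C\<close>] tendsto_const[of q]] by simp
  have "A_spectral_radius A F \<le> root n C * q" if "1 \<le> n" for n
  proof -
    have "A_opnorm A (F ^^ n) \<le> C * q ^ n"
      using bound assms(2,3) by (intro A_opnorm_le) auto
    then have "root n (A_opnorm A (F ^^ n)) \<le> root n C * q"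
      using that assms(3) by (metis One_nat_def Suc_le_lessD real_root_le_mono real_root_mult
          real_root_power_cancel)
    then show ?thesis
      using A_spectral_radius_lower[OF F that] by linarith
  qed
  then show "\<exists>N. \<forall>n\<ge>N. A_spectral_radius A F \<le> root n C * q"
    by blast
qed

section \<open>Comparison of the \<open>A\<close>-seminorm with the Hilbert space norm\<close>

lemma A_seminorm_le_norm: "\<exists>M>0. \<forall>x. A_seminorm A x \<le> M * norm x"
proof -
  \<comment> \<open>For the identity operator the seminorm is the ordinary norm, so Cauchy-Schwarz
    for the original inner product comes from the same lemma.\<close>
  interpret I: positive_operator "\<lambda>x :: 'a. x"
    by standard (simp add: positive_op_def bounded_clinear_id cinner_self_nonneg)
  obtain K where K: "0 < K" "\<And>x. norm (A x) \<le> norm x * K"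
    using bounded_linear.pos_bounded[OF bounded_clinearD(1)[OF clinear]] by blast
  have "A_seminorm A x \<le> sqrt K * norm x" for x
  proof (rule power2_le_imp_le)
    have "form x x \<le> norm (A x) * norm x"
      using I.form_Cauchy_Schwarz[of "A x" x]
      by (simp add: A_inner_def A_seminorm_def norm_eq_sqrt_cinner[symmetric])
    also have "\<dots> \<le> K * norm x * norm x"
      using mult_right_mono[OF K(2)[of x] norm_ge_zero[of x]] by (simp add: mult_ac)
    finally show "(A_seminorm A x)\<^sup>2 \<le> (sqrt K * norm x)\<^sup>2"
      using K(1) by (simp add: A_seminorm_square power_mult_distrib) (simp add: power2_eq_square)
  qed (use K(1) in simp)
  then show ?thesis
    using K(1) by (auto intro!: exI[of _ "sqrt K"])
qed

end

locale positive_invertible_operator = positive_operator +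
  assumes invertible: "invertible_op A"
begin

text \<open>With \<open>B\<close> the inverse of \<open>A\<close>: \<open>\<parallel>x\<parallel>\<^sup>2 = \<langle>B x | x\<rangle>\<^sub>A \<le> \<parallel>B x\<parallel>\<^sub>A \<parallel>x\<parallel>\<^sub>A\<close>.\<close>

lemma norm_le_A_seminorm: "\<exists>m>0. \<forall>x. norm x \<le> m * A_seminorm A x"
proof -
  obtain B where B: "bounded_clinear B" "A \<circ> B = id"
    using invertible by (auto simp: invertible_op_def)
  obtain K where K: "0 < K" "\<And>x. norm (B x) \<le> norm x * K"
    using bounded_linear.pos_bounded[OF bounded_clinearD(1)[OF B(1)]] by blast
  obtain M where M: "0 < M" "\<And>x. A_seminorm A x \<le> M * norm x"
    using A_seminorm_le_norm by blast
  have "norm x \<le> M * K * A_seminorm A x" for x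
  proof (cases "x = 0")
    case False
    have "A_seminorm A (B x) \<le> M * K * norm x"
      using order_trans[OF M(2)[of "B x"] mult_left_mono[OF K(2)[of x], of M]] M(1)
      by (simp add: mult_ac)
    have AB: "A (B x) = x"
      using B(2) by (metis comp_apply id_apply)
    have "norm x * norm x = form (B x) x"
      using cinner_self_nonneg[of x]
      by (simp add: A_inner_def AB norm_eq_sqrt_cinner complex_nonneg_Reals_iff)
    also have "\<dots> \<le> M * K * norm x * A_seminorm A x"
      using form_Cauchy_Schwarz[of "B x" x] mult_right_mono[OF \<open>_ \<le> M * K * norm x\<close>]
        A_seminorm_nonneg[of x] by (meson order_trans)
    finally have "norm x * norm x \<le> norm x * (M * K * A_seminorm A x)"
      by (simp add: mult_ac)
    then show ?thesis
      using False by simp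
  qed (simp add: A_seminorm_zero)
  then show ?thesis
    using K M by (intro exI[of _ "M * K"]) simp
qed

text \<open>The two norms are equivalent for invertible \<open>A\<close>, so they have the same
  bounded operators.\<close>

lemma A_bounded_iff_bounded_clinear: "T \<in> A_bounded_ops A \<longleftrightarrow> bounded_clinear T"
proof
  assume T: "bounded_clinear T"
  obtain K where K: "0 < K" "\<And>x. norm (T x) \<le> norm x * K"
    using bounded_linear.pos_bounded[OF bounded_clinearD(1)[OF T]] by blast
  obtain M where M: "0 < M" "\<And>x. A_seminorm A x \<le> M * norm x"
    using A_seminorm_le_norm by blast
  obtain m where m: "0 < m" "\<And>x. norm x \<le> m * A_seminorm A x"
    using norm_le_A_seminorm by blast
  have "A_seminorm A (T x) \<le> (M * K * m) * A_seminorm A x" for x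
  proof -
    have "A_seminorm A (T x) \<le> M * norm (T x)"
      by (rule M)
    also have "\<dots> \<le> M * (norm x * K)"
      using M(1) K(2) by simp
    also have "\<dots> \<le> M * (m * A_seminorm A x * K)"
      using M(1) K(1) m(2) by simp
    finally show ?thesis
      by (simp add: mult_ac)
  qed
  then show "T \<in> A_bounded_ops A"
    using T A_seminorm_nonneg by (intro A_bounded_opsI)
qed (simp add: A_bounded_ops_def)

lemma A_seminorm_eq_0: "A_seminorm A x = 0 \<longleftrightarrow> x = 0"
proof
  obtain m where "\<And>x. norm x \<le> m * A_seminorm A x"
    using norm_le_A_seminorm by blast
  then show "x = 0" if "A_seminorm A x = 0"
    using that by (metis mult_zero_right norm_le_zero_iff)
qed (simp add: A_seminorm_zero)

section \<open>Operator series converging in the \<open>A\<close>-operator norm\<close>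

text \<open>At each \<open>x\<close> the error is at most its operator norm times
  \<open>A_seminorm A x\<close>. This pointwise form serves both uniqueness of the limit and the
  later estimate of \<open>p (F x)\<close>.\<close>

lemma A_sumsD:
  assumes "A_sums A S F" and S: "\<And>n. bounded_clinear (S n)"
  shows "bounded_clinear F"
    and "(\<lambda>N. A_seminorm A ((\<Sum>n<N. S n x) - F x)) \<longlonglongrightarrow> 0"
proof -
  show F: "bounded_clinear F"
    using assms(1) by (simp add: A_sums_def A_bounded_ops_def)
  have bd: "(\<lambda>x. (\<Sum>n<N. S n x) - F x) \<in> A_bounded_ops A" for N
    by (simp add: A_bounded_iff_bounded_clinear bounded_clinear_diff bounded_clinear_sum S F)
  have lim: "(\<lambda>N. A_opnorm A (\<lambda>x. (\<Sum>n<N. S n x) - F x) * A_seminorm A x) \<longlonglongrightarrow> 0 * A_seminorm A x"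
    using assms(1) by (intro tendsto_mult tendsto_const) (simp add: A_sums_def)
  show "(\<lambda>N. A_seminorm A ((\<Sum>n<N. S n x) - F x)) \<longlonglongrightarrow> 0"
    by (rule tendsto_sandwich[OF _ _ tendsto_const lim[simplified]])
      (intro always_eventually allI A_seminorm_nonneg A_seminorm_le_A_opnorm[OF bd])+
qed

text \<open>Pointwise limits agree because the seminorm of an invertible \<open>A\<close> is
  definite. This justifies the definite description in \<open>op_power_series\<close>.\<close>

lemma A_sums_unique:
  assumes F: "A_sums A S F" and G: "A_sums A S G" and S: "\<And>n. bounded_clinear (S n)"
  shows "F = G"
proof
  fix x
  let ?d = "\<lambda>H N. A_seminorm A ((\<Sum>n<N. S n x) - H x)"
  have "A_seminorm A (F x - G x) \<le> ?d F N + ?d G N" for N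
    using A_seminorm_triangle[of "- ((\<Sum>n<N. S n x) - F x)" "(\<Sum>n<N. S n x) - G x"]
      A_seminorm_minus[of "(\<Sum>n<N. S n x) - F x"] by simp
  moreover have "(\<lambda>N. ?d F N + ?d G N) \<longlonglongrightarrow> 0"
    using tendsto_add[OF A_sumsD(2)[OF F S] A_sumsD(2)[OF G S]] by simp
  ultimately have "A_seminorm A (F x - G x) \<le> 0"
    by (intro LIMSEQ_le_const) auto
  then show "F x = G x"
    using A_seminorm_nonneg[of "F x - G x"] A_seminorm_eq_0[of "F x - G x"] by simp
qed

text \<open>A Weierstrass test: the sum is formed pointwise in the Hilbert space norm, and the tails
  of \<open>b\<close> bound the error in operator norm up to the constants \<open>m\<close> and
  \<open>M\<close> of the norm equivalence.\<close>

lemma A_sums_if_absolutely_summable: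
  assumes S: "\<And>n. bounded_clinear (S n)"
    and bound: "\<And>n x. A_seminorm A (S n x) \<le> b n * A_seminorm A x"
    and b: "summable b" "\<And>n. 0 \<le> b n"
  shows "A_sums A S (\<lambda>x. \<Sum>n. S n x)"
proof -
  let ?F = "\<lambda>x. \<Sum>n. S n x"
  obtain M where M: "0 < M" "\<And>x. A_seminorm A x \<le> M * norm x"
    using A_seminorm_le_norm by blast
  obtain m where m: "0 < m" "\<And>x. norm x \<le> m * A_seminorm A x"
    using norm_le_A_seminorm by blast
  have norm_bound: "norm (S n x) \<le> m * A_seminorm A x * b n" for n x
    using order_trans[OF m(2) mult_left_mono[OF bound, of m]] m(1) by (simp add: mult_ac)
  have b_tail: "summable (\<lambda>n. m * A_seminorm A x * b (n + N))" for x N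
    using b(1) by (intro summable_mult) (simp add: summable_iff_shift)
  \<comment> \<open>Completeness of the space enters here.\<close>
  have summable_S: "summable (\<lambda>n. S n x)" for x
    by (rule summable_comparison_test'[OF b_tail[of x 0], of 0]) (simp add: norm_bound)
  \<comment> \<open>Besides the rate of convergence, the case \<open>N = 0\<close> yields
    boundedness of the sum.\<close>
  have tail: "norm (?F x - (\<Sum>n<N. S n x)) \<le> m * A_seminorm A x * (\<Sum>n. b (n + N))" for x N
  proof -
    have "?F x - (\<Sum>n<N. S n x) = (\<Sum>n. S (n + N) x)"
      using suminf_split_initial_segment[OF summable_S[of x], of N] by simp
    also have "norm \<dots> \<le> (\<Sum>n. m * A_seminorm A x * b (n + N))"
      by (rule norm_suminf_le[OF _ b_tail]) (rule norm_bound)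
    finally show ?thesis
      using b(1) by (simp add: suminf_mult summable_iff_shift)
  qed
  have F: "bounded_clinear ?F"
    unfolding bounded_clinear_def
  proof (intro conjI allI)
    show "bounded_linear ?F"
    proof (rule bounded_linear_intro)
      show "?F (x + y) = ?F x + ?F y" for x y
        by (simp only: bounded_clinearD(3)[OF S] suminf_add[OF summable_S[of x] summable_S[of y]])
      show "?F (r *\<^sub>R x) = r *\<^sub>R ?F x" for r x
        by (simp only: bounded_clinearD(4)[OF S] suminf_scaleR_right[OF summable_S[of x]])
      show "norm (?F x) \<le> norm x * (m * M * suminf b)" for x
      proof -
        have "norm (?F x) \<le> m * A_seminorm A x * suminf b"
          using tail[of x 0] by simp
        also have "\<dots> \<le> m * (M * norm x) * suminf b"
          using m(1) M(2) suminf_nonneg[OF b] by (intro mult_right_mono mult_left_mono) auto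
        finally show ?thesis
          by (simp add: mult_ac)
      qed
    qed
    show "?F (a *\<^sub>C x) = a *\<^sub>C ?F x" for a x
      by (simp only: bounded_clinearD(2)[OF S]
          bounded_linear.suminf[OF bounded_linear_scaleC summable_S[of x]])
  qed
  have op_tail: "A_opnorm A (\<lambda>x. (\<Sum>n<N. S n x) - ?F x) \<le> M * m * (\<Sum>n. b (n + N))" for N
  proof (rule A_opnorm_le)
    show "0 \<le> M * m * (\<Sum>n. b (n + N))"
      using M(1) m(1) b by (intro mult_nonneg_nonneg suminf_nonneg) (auto simp: summable_iff_shift)
    fix x
    have "A_seminorm A ((\<Sum>n<N. S n x) - ?F x) \<le> M * norm (?F x - (\<Sum>n<N. S n x))"
      using M(2)[of "(\<Sum>n<N. S n x) - ?F x"] by (simp add: norm_minus_commute)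
    also have "\<dots> \<le> M * (m * A_seminorm A x * (\<Sum>n. b (n + N)))"
      using M(1) by (intro mult_left_mono tail) simp
    finally show "A_seminorm A ((\<Sum>n<N. S n x) - ?F x) \<le> M * m * (\<Sum>n. b (n + N)) * A_seminorm A x"
      by (simp add: mult_ac)
  qed
  have op_nonneg: "0 \<le> A_opnorm A (\<lambda>x. (\<Sum>n<N. S n x) - ?F x)" for N
    by (intro A_opnorm_upper(2))
      (simp add: A_bounded_iff_bounded_clinear bounded_clinear_diff bounded_clinear_sum S F)
  have lim: "(\<lambda>N. M * m * (\<Sum>n. b (n + N))) \<longlonglongrightarrow> M * m * 0"
    by (intro tendsto_mult tendsto_const suminf_exist_split2 b)
  have "(\<lambda>N. A_opnorm A (\<lambda>x. (\<Sum>n<N. S n x) - ?F x)) \<longlonglongrightarrow> 0"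
    by (rule tendsto_sandwich[OF _ _ tendsto_const lim[simplified]])
      (intro always_eventually allI op_nonneg op_tail)+
  then show ?thesis
    by (simp add: A_sums_def A_bounded_iff_bounded_clinear F)
qed

text \<open>Existence comes from the majorant with powers of \<open>A_opnorm A T\<close>; together
  with uniqueness it shows that the definite description picks the actual limit.\<close>

lemma A_sums_op_power_series:
  assumes "T \<in> A_bounded_ops A" and "summable (\<lambda>n. norm (c n) * A_opnorm A T ^ n)"
  shows "A_sums A (\<lambda>n x. c n *\<^sub>C (T ^^ n) x) (op_power_series A c T)"
proof -
  have lin: "bounded_clinear (\<lambda>x. c n *\<^sub>C (T ^^ n) x)" for n
    using assms(1)
    by (simp add: A_bounded_iff_bounded_clinear bounded_clinear_scaleC bounded_clinear_funpow)
  have "A_seminorm A (c n *\<^sub>C (T ^^ n) x) \<le> norm (c n) * A_opnorm A T ^ n * A_seminorm A x" for n x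
    using A_seminorm_funpow_le[OF assms(1)]
    by (simp add: A_seminorm_scaleC mult.assoc mult_left_mono)
  then have F: "A_sums A (\<lambda>n x. c n *\<^sub>C (T ^^ n) x) (\<lambda>x. \<Sum>n. c n *\<^sub>C (T ^^ n) x)"
    using assms(2) A_opnorm_upper(2)[OF assms(1)]
    by (intro A_sums_if_absolutely_summable[where b = "\<lambda>n. norm (c n) * A_opnorm A T ^ n"] lin) auto
  then show ?thesis
    unfolding op_power_series_def
  proof (rule theI[where P = "A_sums A (\<lambda>n x. c n *\<^sub>C (T ^^ n) x)"])
    show "G = (\<lambda>x. \<Sum>n. c n *\<^sub>C (T ^^ n) x)" if "A_sums A (\<lambda>n x. c n *\<^sub>C (T ^^ n) x) G" for G
      using that F by (rule A_sums_unique) (rule lin)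
  qed
qed

section \<open>The bound for \<open>s\<close> strictly above the spectral radius\<close>

lemma A_spectral_radius_power_series_le:
  assumes T: "T \<in> A_bounded_ops A"
    and F: "A_sums A (\<lambda>n x. c n *\<^sub>C (T ^^ n) x) F"
    and s: "A_spectral_radius A T < s"
    and summ: "summable (\<lambda>n. norm (c n) * s ^ n)"
  shows "A_spectral_radius A F \<le> (\<Sum>n. norm (c n) * s ^ n)"
proof -
  define q where "q = (\<Sum>n. norm (c n) * s ^ n)"
  have s0: "0 < s"
    using s A_spectral_radius_nonneg[OF T] by linarith
  have q0: "0 \<le> q"
    unfolding q_def using s0 by (intro suminf_nonneg summ) simp
  have T_clin: "bounded_clinear T"
    using T by (simp add: A_bounded_ops_def)
  have lin: "bounded_clinear (\<lambda>x. c n *\<^sub>C (T ^^ n) x)" for n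
    by (simp add: T_clin bounded_clinear_scaleC bounded_clinear_funpow)
  obtain k where k: "1 \<le> k" "A_opnorm A (T ^^ k) \<le> s ^ k"
    using A_spectral_radius_lessD[OF T s] by blast
  \<comment> \<open>\<open>k'\<close> is \<open>k - 1\<close>; for \<open>j < k\<close> the exponent
    \<open>k' - j\<close> is never truncated.\<close>
  obtain k' where k': "k = Suc k'"
    using k(1) by (cases k) auto
  \<comment> \<open>With these weights, term \<open>j\<close> of \<open>p (T x)\<close> is
    \<open>s\<close> times term \<open>j + 1\<close> of \<open>p x\<close>. Only the top term,
    containing \<open>T ^^ k\<close>, is left over, and the choice of \<open>k\<close> bounds
    it.\<close>
  define p where "p x = (\<Sum>j<k. s ^ (k' - j) * A_seminorm A ((T ^^ j) x))" for x
  have p_nonneg: "0 \<le> p x" for x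
    unfolding p_def using s0 A_seminorm_nonneg by (intro sum_nonneg) simp
  \<comment> \<open>Only the term \<open>j = 0\<close> is kept.\<close>
  have p_lower: "s ^ k' * A_seminorm A x \<le> p x" for x
    unfolding p_def k' sum.lessThan_Suc_shift
    using s0 A_seminorm_nonneg by (simp add: sum_nonneg)
  define D where "D = (\<Sum>j<k. s ^ (k' - j) * A_opnorm A T ^ j)"
  have p_upper: "p x \<le> D * A_seminorm A x" for x
    unfolding p_def D_def sum_distrib_right mult.assoc
    using s0 A_seminorm_funpow_le[OF T] by (intro sum_mono mult_left_mono) auto
  have p_add: "p (x + y) \<le> p x + p y" for x y
    unfolding p_def sum.distrib[symmetric] distrib_left[symmetric]
    using s0 A_seminorm_triangle
    by (intro sum_mono mult_left_mono)
      (auto simp: bounded_clinearD(3)[OF bounded_clinear_funpow[OF T_clin]])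
  have p_scaleC: "p (a *\<^sub>C x) = norm a * p x" for a x
    unfolding p_def sum_distrib_left
    by (simp add: bounded_clinearD(2)[OF bounded_clinear_funpow[OF T_clin]] A_seminorm_scaleC
        mult_ac)
  have p_zero: "p 0 = 0"
    using p_upper[of 0] p_nonneg[of 0] by (simp add: A_seminorm_zero)
  have p_sum: "p (\<Sum>n<N. g n) \<le> (\<Sum>n<N. p (g n))" for g and N :: nat
  proof (induction N)
    case (Suc N)
    then show ?case
      using p_add[of "\<Sum>n<N. g n" "g N"] by simp
  qed (simp add: p_zero)
  have p_T: "p (T x) \<le> s * p x" for x
  proof -
    have shift: "(T ^^ j) (T x) = (T ^^ Suc j) x" for j
      by (simp only: funpow_Suc_right comp_apply)
    have "A_seminorm A ((T ^^ k) x) \<le> A_opnorm A (T ^^ k) * A_seminorm A x"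
      by (rule A_seminorm_le_A_opnorm[OF A_bounded_funpow[OF T]])
    also have "\<dots> \<le> s ^ k * A_seminorm A x"
      by (rule mult_right_mono[OF k(2) A_seminorm_nonneg])
    finally have last: "A_seminorm A ((T ^^ k) x) \<le> s ^ k * A_seminorm A x" .
    have "p (T x) = (\<Sum>j<k'. s ^ (k' - j) * A_seminorm A ((T ^^ Suc j) x))
        + A_seminorm A ((T ^^ k) x)"
      unfolding p_def shift by (simp add: k')
    \<comment> \<open>Here \<open>j < k'\<close>, so \<open>k' - j = Suc (k' - Suc j)\<close> and
      one factor \<open>s\<close> splits off.\<close>
    also have "(\<Sum>j<k'. s ^ (k' - j) * A_seminorm A ((T ^^ Suc j) x))
        = (\<Sum>j<k'. s * (s ^ (k' - Suc j) * A_seminorm A ((T ^^ Suc j) x)))"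
      by (intro sum.cong refl) (simp add: Suc_diff_Suc flip: mult.assoc power_Suc del: funpow.simps)
    also have "\<dots> + A_seminorm A ((T ^^ k) x) \<le> \<dots> + s ^ k * A_seminorm A x"
      using last by simp
    \<comment> \<open>The summand \<open>s ^ k * A_seminorm A x\<close> is \<open>s\<close> times
      the missing term \<open>j = 0\<close> of \<open>p x\<close>.\<close>
    also have "\<dots> = s * p x"
      unfolding p_def k' sum.lessThan_Suc_shift by (simp add: sum_distrib_left algebra_simps)
    finally show ?thesis .
  qed
  have p_funpow: "p ((T ^^ n) x) \<le> s ^ n * p x" for n x
  proof (induction n)
    case (Suc n)
    then show ?case
      using order_trans[OF p_T mult_left_mono[OF Suc, of s]] s0 by (simp add: mult.assoc)
  qed simp
  \<comment> \<open>Partial sums satisfy the bound by subadditivity of \<open>p\<close>. It passes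
    to the limit since \<open>p_upper\<close> makes \<open>p\<close> of the error at most
    \<open>D\<close> times its \<open>A\<close>-seminorm, which tends to \<open>0\<close>.\<close>
  have p_F: "p (F x) \<le> q * p x" for x
  proof (rule LIMSEQ_le_const)
    let ?S = "\<lambda>N. \<Sum>n<N. c n *\<^sub>C (T ^^ n) x"
    have "(\<lambda>N. D * A_seminorm A (?S N - F x) + q * p x) \<longlonglongrightarrow> D * 0 + q * p x"
      by (intro tendsto_intros A_sumsD(2)[OF F lin])
    then show "(\<lambda>N. D * A_seminorm A (?S N - F x) + q * p x) \<longlonglongrightarrow> q * p x"
      by simp
    have "p (F x) \<le> D * A_seminorm A (?S N - F x) + q * p x" for N
    proof -
      have "p (?S N) \<le> (\<Sum>n<N. norm (c n) * s ^ n * p x)"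
        using p_sum[of "\<lambda>n. c n *\<^sub>C (T ^^ n) x" N]
          sum_mono[of "{..<N}" "\<lambda>n. p (c n *\<^sub>C (T ^^ n) x)" "\<lambda>n. norm (c n) * s ^ n * p x"]
          mult_left_mono[OF p_funpow, of "norm (c _)"]
        by (simp add: p_scaleC mult.assoc)
      also have "\<dots> \<le> q * p x"
        unfolding q_def sum_distrib_right[symmetric]
        using s0 by (intro mult_right_mono p_nonneg sum_le_suminf summ) auto
      finally have "p (?S N) \<le> q * p x" .
      moreover have "p (- (?S N - F x)) \<le> D * A_seminorm A (?S N - F x)"
        using p_upper[of "- (?S N - F x)"] by (simp only: A_seminorm_minus)
      moreover have "p (F x) \<le> p (- (?S N - F x)) + p (?S N)"
        using p_add[of "- (?S N - F x)" "?S N"] by simp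
      ultimately show ?thesis
        by linarith
    qed
    then show "\<exists>N. \<forall>n\<ge>N. p (F x) \<le> D * A_seminorm A (?S n - F x) + q * p x"
      by blast
  qed
  have p_F_funpow: "p ((F ^^ n) x) \<le> q ^ n * p x" for n x
  proof (induction n)
    case (Suc n)
    then show ?case
      using p_F[of "(F ^^ n) x"] mult_left_mono[OF Suc q0] by (simp add: mult.assoc)
  qed simp
  \<comment> \<open>Strict positivity is what makes the \<open>n\<close>-th roots of the constant
    tend to \<open>1\<close>; the term \<open>j = 0\<close> of \<open>D\<close> is already
    positive.\<close>
  have D0: "0 < D"
  proof -
    have "0 < s ^ k'"
      using s0 by simp
    also have "\<dots> \<le> D"
      unfolding D_def k' sum.lessThan_Suc_shift
      using s0 A_opnorm_upper(2)[OF T] by (simp add: sum_nonneg)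
    finally show ?thesis .
  qed
  have "A_spectral_radius A F \<le> q"
  proof (rule A_spectral_radius_le)
    show "F \<in> A_bounded_ops A"
      using F by (simp add: A_sums_def)
    \<comment> \<open>The equivalence constant: \<open>p_upper\<close> contributes \<open>D\<close>,
      and \<open>p_lower\<close> the division by \<open>s ^ k'\<close>.\<close>
    show "0 < D / s ^ k'"
      using D0 s0 by simp
    show "A_seminorm A ((F ^^ n) x) \<le> D / s ^ k' * q ^ n * A_seminorm A x" for n x
    proof -
      have "s ^ k' * A_seminorm A ((F ^^ n) x) \<le> q ^ n * p x"
        using p_lower p_F_funpow by (rule order_trans)
      also have "\<dots> \<le> q ^ n * (D * A_seminorm A x)"
        using p_upper q0 by (intro mult_left_mono) auto
      finally show ?thesis
        using s0 by (simp add: field_simps)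
    qed
  qed (rule q0)
  then show ?thesis
    by (simp add: q_def)
qed

end

text \<open>The first two conjuncts ensure that \<open>op_power_series A c T\<close> is a genuine
  limit and that the infinite sum on the right is a genuine value, not defaults of
  \<open>THE\<close> and \<open>suminf\<close>.\<close>

theorem theorem3p1:
  fixes A T :: "'a :: chilbert_space \<Rightarrow> 'a"
    and c :: "nat \<Rightarrow> complex"
    and R :: real
  assumes "positive_op A"
    and "invertible_op A"
    and "T \<in> A_bounded_ops A"
    and "R > 0"
    and "\<And>z. z \<in> ball 0 R \<Longrightarrow> summable (\<lambda>n. c n * z ^ n)"
    and "A_opnorm A T < R"
  shows "A_sums A (\<lambda>n x. c n *\<^sub>C (T ^^ n) x) (op_power_series A c T) \<and>
    summable (\<lambda>n. norm (c n) * A_spectral_radius A T ^ n) \<and>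
    A_spectral_radius A (op_power_series A c T)
           \<le> (\<Sum>n. norm (c n) * A_spectral_radius A T ^ n)"
proof -
  interpret positive_invertible_operator A
    using assms(1,2) by unfold_locales
  let ?r = "A_spectral_radius A T" and ?f = "\<lambda>s. \<Sum>n. norm (c n) * s ^ n"
  note T = assms(3)
  \<comment> \<open>Convergence at a point \<open>K\<close> strictly between \<open>s\<close> and
    \<open>R\<close> gives absolute convergence at \<open>s\<close>.\<close>
  have summ: "summable (\<lambda>n. norm (c n) * s ^ n)" if "0 \<le> s" "s < R" for s
  proof -
    obtain K where K: "s < K" "K < R"
      using dense[OF \<open>s < R\<close>] by blast
    have "summable (\<lambda>n. c n * complex_of_real K ^ n)"
      using K that by (intro assms(5)) simp
    then have "summable (\<lambda>n. norm (c n * complex_of_real s ^ n))"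
      using K that by (intro powser_insidea) auto
    then show ?thesis
      using that by (simp add: norm_mult norm_power)
  qed
  have r: "0 \<le> ?r" "?r < R"
    using A_spectral_radius_nonneg[OF T] A_spectral_radius_le_A_opnorm[OF T] assms(6) by auto
  have sums: "A_sums A (\<lambda>n x. c n *\<^sub>C (T ^^ n) x) (op_power_series A c T)"
    using A_opnorm_upper(2)[OF T] assms(6) by (intro A_sums_op_power_series T summ) auto
  obtain K where K: "?r < K" "K < R"
    using dense[OF r(2)] by blast
  \<comment> \<open>The infimum defining \<open>?r\<close> need not be attained, so the estimate is
    available only for \<open>s > ?r\<close>; continuity of the majorant carries it to
    \<open>?r\<close>.\<close>
  have "isCont ?f ?r"
    using K r by (intro isCont_powser[where K = K] summ) auto
  then have "(?f \<longlongrightarrow> ?f ?r) (at_right ?r)"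
    unfolding isCont_def by (rule filterlim_mono[OF _ order_refl at_le]) simp
  \<comment> \<open>The estimate holds on the whole open interval from \<open>?r\<close> to
    \<open>R\<close>.\<close>
  moreover have "\<forall>\<^sub>F s in at_right ?r. A_spectral_radius A (op_power_series A c T) \<le> ?f s"
    using r
    by (intro eventually_at_rightI[OF _ r(2)] A_spectral_radius_power_series_le[OF T sums] summ)
      auto
  ultimately have "A_spectral_radius A (op_power_series A c T) \<le> ?f ?r"
    by (rule tendsto_lowerbound) (rule trivial_limit_at_right_real)
  then show ?thesis
    using sums summ[OF r] by blast
qed

end
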